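(* Let $ABC$ be a triangle inscribed in a circle $\Gamma$, and let $D_4$ be a point, distinct from $A,B,C$ and from the orthocentre of $ABC$. Let $\mathcal{C}$ be a central conic (an ellipse or a hyperbola), with centre $M$, passing through $A, B, C, D_4$ and such that the image $D$ of $D_4$ under the $180^\circ$ rotation about $M$ lies on $\Gamma$ and is distinct from $A,B,C$. Let $A_1, B_2, C_3$ be the images of $A, B, C$ respectively under the $180^\circ$ rotation about $M$. Let $P$ be a point of $\mathcal{C}$, not on $\Gamma$ or on the side lines of $ABC$, and distinct from $A_1,B_2,C_3,D_4$. Define $$A_4=A_1P\cap AD_4,\quad B_4=B_2P\cap BD_4,\quad C_4=C_3P\cap CD_4,$$ $$B_1=B_2P\cap BA_1,\quad C_1=C_3P\cap CA_1,\quad D_1=D_4P\cap DA_1,$$ $$A_2=A_1P\cap AB_2,\quad C_2=C_3P\cap CB_2,\quad D_2=D_4P\cap DB_2,$$ $$A_3=A_1P\cap AC_3,\quad B_3=B_2P\cap BC_3,\quad D_3=D_4P\cap DC_3,$$ and let $\Sigma_4$, $\Sigma_1$, $\Sigma_2$, $\Sigma_3$ be the circles $A_4B_4C_4$, $B_1C_1D_1$, $A_2C_2D_2$, $A_3B_3D_3$ respectively (these pass through $D_4, A_1, B_2, C_3$ respectively). Let the circle $BCD_4$ meet $\Sigma_4$ again (other than at $D_4$) at $A_4'$; then the line $A_4A_4'$ passes through $P$. Similarly, if the circles $CAD_4$, $ABD_4$ meet $\Sigma_4$ again at $B_4'$, $C_4'$, then $B_4B_4'$ and $C_4C_4'$ pass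 through $P$; if the circles $CDA_1$, $BDA_1$, $BCA_1$ meet $\Sigma_1$ again (other than at $A_1$) at $B_1', C_1', D_1'$, then $B_1B_1'$, $C_1C_1'$, $D_1D_1'$ pass through $P$; if the circles $CDB_2$, $ADB_2$, $ACB_2$ meet $\Sigma_2$ again (other than at $B_2$) at $A_2', C_2', D_2'$, then $A_2A_2'$, $C_2C_2'$, $D_2D_2'$ pass through $P$; and if the circles $BDC_3$, $ADC_3$, $ABC_3$ meet $\Sigma_3$ again (other than at $C_3$) at $A_3', B_3', D_3'$, then $A_3A_3'$, $B_3B_3'$, $D_3D_3'$ pass through $P$.
   Context: All objects lie in the Euclidean plane. For distinct points $R,S$, $RS$ denotes the line through them, and for non-collinear points $R,S,T$, circle $RST$ is the circle through them. Conics are non-degenerate. The configuration is assumed non-degenerate: each line named joins two distinct points, each pair of lines named meets in exactly one point, the triples of points defining circles are not collinear, and each pair of circles whose second intersection is taken consists of distinct circles meeting in two points. *)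

theory Defs
  imports "HOL-Analysis.Analysis"
begin

type_synonym point = "real^2"

text \<open>Meaningful for distinct points only; \<open>lines_meet_at\<close> builds this requirement in.\<close>

definition line_through :: "point \<Rightarrow> point \<Rightarrow> point set" where
  "line_through R S = affine hull {R, S}"

definition lines_meet_at :: "point \<Rightarrow> point \<Rightarrow> point \<Rightarrow> point \<Rightarrow> point \<Rightarrow> bool" where
  "lines_meet_at R S T U X \<longleftrightarrow>
     R \<noteq> S \<and> T \<noteq> U \<and> line_through R S \<inter> line_through T U = {X}"

definition is_circle :: "point set \<Rightarrow> bool" where
  "is_circle K \<longleftrightarrow> (\<exists>c r. 0 < r \<and> K = sphere c r)"

text \<open>Unspecified for collinear triples; see \<open>circumcircle_props\<close> for the other ones.\<close>

definition circumcircle :: "point \<Rightarrow> point \<Rightarrow> point \<Rightarrow> point set" where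
  "circumcircle R S T = (THE K. is_circle K \<and> R \<in> K \<and> S \<in> K \<and> T \<in> K)"

text \<open>\<open>X\<close> is the intersection point other than \<open>Y\<close> of two distinct circles meeting in two points.\<close>

definition circles_meet_again :: "point set \<Rightarrow> point set \<Rightarrow> point \<Rightarrow> point \<Rightarrow> bool" where
  "circles_meet_again K L Y X \<longleftrightarrow> K \<noteq> L \<and> X \<noteq> Y \<and> K \<inter> L = {X, Y}"

definition is_orthocentre :: "point \<Rightarrow> point \<Rightarrow> point \<Rightarrow> point \<Rightarrow> bool" where
  "is_orthocentre A B C H \<longleftrightarrow>
     (H - A) \<bullet> (B - C) = 0 \<and> (H - B) \<bullet> (C - A) = 0 \<and> (H - C) \<bullet> (A - B) = 0"

definition half_turn :: "point \<Rightarrow> point \<Rightarrow> point" where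
  "half_turn M X = 2 *\<^sub>R M - X"

text \<open>Standard equations with respect to an arbitrary orthonormal frame at the centre.
  Circles count as ellipses; a hyperbola consists of both branches.\<close>

definition is_ellipse :: "point \<Rightarrow> point set \<Rightarrow> bool" where
  "is_ellipse M K \<longleftrightarrow>
     (\<exists>u v a b. norm u = 1 \<and> norm v = 1 \<and> u \<bullet> v = 0 \<and> 0 < a \<and> 0 < b \<and>
        K = {M + x *\<^sub>R u + y *\<^sub>R v | x y. x\<^sup>2 / a\<^sup>2 + y\<^sup>2 / b\<^sup>2 = 1})"

definition is_hyperbola :: "point \<Rightarrow> point set \<Rightarrow> bool" where
  "is_hyperbola M K \<longleftrightarrow>
     (\<exists>u v a b. norm u = 1 \<and> norm v = 1 \<and> u \<bullet> v = 0 \<and> 0 < a \<and> 0 < b \<and>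
        K = {M + x *\<^sub>R u + y *\<^sub>R v | x y. x\<^sup>2 / a\<^sup>2 - y\<^sup>2 / b\<^sup>2 = 1})"

definition is_central_conic :: "point \<Rightarrow> point set \<Rightarrow> bool" where
  "is_central_conic M K \<longleftrightarrow> is_ellipse M K \<or> is_hyperbola M K"

lemma not_collinear_det:
  fixes R S T :: point
  assumes "\<not> collinear {R, S, T}"
  shows "(S$1 - R$1) * (T$2 - R$2) - (S$2 - R$2) * (T$1 - R$1) \<noteq> 0"
proof
  assume det: "(S$1 - R$1) * (T$2 - R$2) - (S$2 - R$2) * (T$1 - R$1) = 0"
  have ne: "S - R \<noteq> 0"
    using assms by (auto simp: insert_commute)
  define n where "n = (S$1 - R$1)\<^sup>2 + (S$2 - R$2)\<^sup>2"
  have n0: "n \<noteq> 0"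
    using ne by (auto simp: n_def vec_eq_iff forall_2 sum_power2_eq_zero_iff)
  define k where "k = ((S$1 - R$1) * (T$1 - R$1) + (S$2 - R$2) * (T$2 - R$2)) / n"
  have kn: "k * n = (S$1 - R$1) * (T$1 - R$1) + (S$2 - R$2) * (T$2 - R$2)"
    using n0 by (simp add: k_def)
  have "n * (T$1 - R$1) = n * (k * (S$1 - R$1))" "n * (T$2 - R$2) = n * (k * (S$2 - R$2))"
    using det kn unfolding n_def by algebra+
  with n0 have "T - R = k *\<^sub>R (S - R)"
    by (simp add: vec_eq_iff forall_2)
  hence "collinear {0, S - R, T - R}"
    unfolding collinear_lemma by blast
  hence "collinear {S, R, T}"
    by (subst collinear_3) simp
  with assms show False
    by (simp add: insert_commute)
qed

lemma dist_eq_iff_plane: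
  fixes c R S :: point
  shows "dist c R = dist c S \<longleftrightarrow>
    2 * ((S$1 - R$1) * (c$1 - R$1) + (S$2 - R$2) * (c$2 - R$2)) =
      (S$1 - R$1)\<^sup>2 + (S$2 - R$2)\<^sup>2"
proof -
  have "dist c R = dist c S \<longleftrightarrow> (dist c R)\<^sup>2 = (dist c S)\<^sup>2"
    by simp
  also have "\<dots> \<longleftrightarrow> (c$1 - R$1)\<^sup>2 + (c$2 - R$2)\<^sup>2 = (c$1 - S$1)\<^sup>2 + (c$2 - S$2)\<^sup>2"
    by (simp only: dist_norm power2_norm_eq_inner)
      (simp add: inner_vec_def sum_2 power2_eq_square)
  also have "\<dots> \<longleftrightarrow> 2 * ((S$1 - R$1) * (c$1 - R$1) + (S$2 - R$2) * (c$2 - R$2)) =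
      (S$1 - R$1)\<^sup>2 + (S$2 - R$2)\<^sup>2"
    by (simp add: power2_eq_square algebra_simps)
  finally show ?thesis .
qed

lemma ex1_circumcircle:
  assumes "\<not> collinear {R, S, T}"
  shows "\<exists>!K. is_circle K \<and> R \<in> K \<and> S \<in> K \<and> T \<in> K"
proof -
  define u1 u2 v1 v2 where "u1 = S$1 - R$1" and "u2 = S$2 - R$2"
    and "v1 = T$1 - R$1" and "v2 = T$2 - R$2"
  note uv = u1_def u2_def v1_def v2_def
  define d where "d = u1 * v2 - u2 * v1"
  have d0: "d \<noteq> 0"
    using not_collinear_det[OF assms] by (simp add: d_def uv)
  define x where "x = ((u1\<^sup>2 + u2\<^sup>2) * v2 - (v1\<^sup>2 + v2\<^sup>2) * u2) / (2 * d)"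
  define y where "y = ((v1\<^sup>2 + v2\<^sup>2) * u1 - (u1\<^sup>2 + u2\<^sup>2) * v1) / (2 * d)"
  have x: "2 * d * x = (u1\<^sup>2 + u2\<^sup>2) * v2 - (v1\<^sup>2 + v2\<^sup>2) * u2"
    and y: "2 * d * y = (v1\<^sup>2 + v2\<^sup>2) * u1 - (u1\<^sup>2 + u2\<^sup>2) * v1"
    using d0 by (simp_all add: x_def y_def)
  have eq: "dist c R = dist c S \<and> dist c R = dist c T \<longleftrightarrow> c$1 - R$1 = x \<and> c$2 - R$2 = y"
    (is "?l \<longleftrightarrow> ?r") for c
  proof
    assume ?l
    hence e: "2 * (u1 * (c$1 - R$1) + u2 * (c$2 - R$2)) = u1\<^sup>2 + u2\<^sup>2"
      "2 * (v1 * (c$1 - R$1) + v2 * (c$2 - R$2)) = v1\<^sup>2 + v2\<^sup>2"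
      unfolding dist_eq_iff_plane uv by blast+
    have "2 * d * (c$1 - R$1) = 2 * d * x" "2 * d * (c$2 - R$2) = 2 * d * y"
      unfolding x y using e d_def by algebra+
    with d0 show ?r by simp
  next
    assume r: ?r
    have "d * (2 * (u1 * x + u2 * y)) = d * (u1\<^sup>2 + u2\<^sup>2)"
      "d * (2 * (v1 * x + v2 * y)) = d * (v1\<^sup>2 + v2\<^sup>2)"
      using x y d_def by algebra+
    with d0 have "2 * (u1 * x + u2 * y) = u1\<^sup>2 + u2\<^sup>2" "2 * (v1 * x + v2 * y) = v1\<^sup>2 + v2\<^sup>2"
      by simp_all
    with r show ?l
      unfolding dist_eq_iff_plane uv by simp
  qed
  define c :: point where "c = vector [R$1 + x, R$2 + y]"
  have c: "c$1 - R$1 = x" "c$2 - R$2 = y"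
    by (simp_all add: c_def vector_2)
  have dc: "dist c S = dist c R" "dist c T = dist c R"
    using eq[of c] c by auto
  have "c \<noteq> R"
  proof
    assume "c = R"
    with dc have "S = R" by simp
    with assms show False by simp
  qed
  show ?thesis
  proof (rule ex1I[of _ "sphere c (dist c R)"])
    show "is_circle (sphere c (dist c R)) \<and> R \<in> sphere c (dist c R) \<and>
        S \<in> sphere c (dist c R) \<and> T \<in> sphere c (dist c R)"
      using \<open>c \<noteq> R\<close> dc unfolding is_circle_def by (metis mem_sphere zero_less_dist_iff)
  next
    fix K
    assume K: "is_circle K \<and> R \<in> K \<and> S \<in> K \<and> T \<in> K"
    then obtain c' r where c': "K = sphere c' r"
      by (auto simp: is_circle_def)
    with K have r: "dist c' R = r" "dist c' S = r" "dist c' T = r"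
      by auto
    hence "c'$1 - R$1 = x \<and> c'$2 - R$2 = y"
      using eq[of c'] by simp
    hence "c' = c"
      using c by (simp add: vec_eq_iff forall_2)
    with c' r show "K = sphere c (dist c R)" by simp
  qed
qed

lemma circumcircle_props:
  assumes "\<not> collinear {R, S, T}"
  shows "is_circle (circumcircle R S T)" "R \<in> circumcircle R S T"
    "S \<in> circumcircle R S T" "T \<in> circumcircle R S T"
  using theI'[OF ex1_circumcircle[OF assms]] by (simp_all add: circumcircle_def)

end

theory Submission
  imports Defs
begin

text \<open>
  Write the conic as \<open>(X - M) \<bullet> Q (X - M) = 1\<close> with \<open>Q\<close> symmetric and invertible, let \<open>X'\<close> be the
  half-turn image of \<open>X\<close> about \<open>M\<close>, and let \<open>J\<close> be \<open>Q\<close> followed by a quarter turn. Two facts about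
  the linear map \<open>J\<close> carry the proof.

  First, \<open>U\<close> and \<open>U'\<close> are the ends of a diameter, so for \<open>V\<close> on the conic the chords \<open>V U\<close> and
  \<open>V U'\<close> have conjugate directions: \<open>V - U'\<close> is a multiple of \<open>J (V - U)\<close>
  (lemma \<open>supplementary_chord\<close>). Second, by the Cayley--Hamilton theorem for \<open>Q\<close>, the squared
  length of \<open>J (X - M)\<close> is an affine function of the squared length of \<open>X - M\<close> while \<open>X\<close> stays on
  the conic; hence \<open>J\<close> sends concyclic points of the conic to concyclic points
  (lemma \<open>J_image_concyclic\<close>).

  The points \<open>A, B, C, D\<close> are concyclic and the four parts of the theorem differ only in which of
  the four points plays the role of \<open>D\<close>, with \<open>E = D'\<close> the antipode through which the circle in
  question passes. Let \<open>X\<close> be the intersection of \<open>A' P\<close> with \<open>A E\<close>, and similarly \<open>Y\<close>, \<open>Z\<close> for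
  \<open>B\<close>, \<open>C\<close>. There is one number \<open>t\<close> such that the map \<open>V \<mapsto> E + t J (V - D)\<close> sends
  \<open>A, B, C, D, P\<close> to \<open>X, Y, Z, E, P\<close> (lemma \<open>projected_point\<close>). By the second fact the images of
  \<open>A, B, C, D\<close> are concyclic, so \<open>E\<close> lies on the circle \<open>X Y Z\<close>.

  The second fact also shows that \<open>A'\<close> lies on the circle \<open>B C E\<close>: the angle of \<open>B C\<close> at \<open>A'\<close> is,
  by the first fact, the angle of \<open>J B\<close>, \<open>J C\<close> at \<open>J A\<close>, and the angle at \<open>E\<close> is the one at \<open>J D\<close>
  (lemma \<open>half_turn_concyclic\<close>). Let \<open>W\<close> be the second common point of the circles \<open>B C E\<close> and
  \<open>X Y Z\<close>. The line \<open>Y B\<close> passes through the common point \<open>E\<close>, and \<open>X Y\<close> is parallel to \<open>A' B\<close>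
  because both have direction \<open>J (B - A)\<close>. The converse of Reim's theorem (lemma \<open>reim\<close>) now puts
  \<open>W\<close> on the line \<open>A' X\<close>, and this line contains \<open>P\<close> by the choice of \<open>X\<close>.
\<close>

section \<open>Cross products and circles in the plane\<close>

definition cross :: "point \<Rightarrow> point \<Rightarrow> real" where
  "cross u v = u$1 * v$2 - u$2 * v$1"

lemma inner_plane: "u \<bullet> v = u$1 * v$1 + u$2 * v$2" for u v :: point
  by (simp add: inner_vec_def sum_2)

lemma point_eq_iff: "u = v \<longleftrightarrow> u$1 = v$1 \<and> u$2 = v$2" for u v :: point
  by (simp add: vec_eq_iff forall_2)

lemma mem_sphere_plane:
  "X \<in> sphere c r \<longleftrightarrow> 0 \<le> r \<and> (X$1 - c$1)\<^sup>2 + (X$2 - c$2)\<^sup>2 = r\<^sup>2" for X c :: point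
proof -
  have "(dist c X)\<^sup>2 = (X$1 - c$1)\<^sup>2 + (X$2 - c$2)\<^sup>2"
    by (simp only: dist_norm power2_norm_eq_inner inner_plane) (simp add: power2_eq_square algebra_simps)
  thus ?thesis
    by (metis mem_sphere power2_eq_iff_nonneg zero_le_dist)
qed

lemma cross_scaleR: "cross (a *\<^sub>R u) (b *\<^sub>R v) = a * b * cross u v"
  by (simp add: cross_def algebra_simps)

lemma cross_eq_0_iff:
  assumes "u \<noteq> 0"
  shows "cross u v = 0 \<longleftrightarrow> (\<exists>k. v = k *\<^sub>R u)"
proof
  assume c: "cross u v = 0"
  define n where "n = u$1 * u$1 + u$2 * u$2"
  have n0: "n \<noteq> 0"
    using assms by (auto simp: n_def point_eq_iff sum_squares_eq_zero_iff)
  have "n * v$1 = (u \<bullet> v) * u$1" "n * v$2 = (u \<bullet> v) * u$2"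
    using c unfolding n_def inner_plane cross_def by algebra+
  hence "v = ((u \<bullet> v) / n) *\<^sub>R u"
    using n0 by (simp add: point_eq_iff field_simps)
  thus "\<exists>k. v = k *\<^sub>R u" ..
qed (auto simp: cross_def)

lemma cross_trans:
  assumes "cross u v = 0" "cross u w = 0" "u \<noteq> 0"
  shows "cross v w = 0"
  using assms cross_eq_0_iff[of u] by (auto simp: cross_def)

lemma mem_line_through_iff:
  assumes "R \<noteq> S"
  shows "X \<in> line_through R S \<longleftrightarrow> cross (S - R) (X - R) = 0"
proof -
  have "X \<in> line_through R S \<longleftrightarrow> (\<exists>k. X - R = k *\<^sub>R (S - R))"
    unfolding line_through_def affine_hull_2_alt by (auto simp: image_iff diff_eq_eq add.commute)
  also have "\<dots> \<longleftrightarrow> cross (S - R) (X - R) = 0"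
    using assms by (subst cross_eq_0_iff) auto
  finally show ?thesis .
qed

text \<open>Both sides compare the tangent of the directed angle \<open>W Y X\<close> with that of \<open>W Z X\<close>. The form
  without quotients also covers right angles and coinciding points, and each difference
  vector enters homogeneously, so that it may be replaced by a parallel one.\<close>

lemma inscribed_angle:
  assumes "W \<in> sphere c r" "X \<in> sphere c r" "Y \<in> sphere c r" "Z \<in> sphere c r"
  shows "cross (W - Y) (X - Y) * ((W - Z) \<bullet> (X - Z)) =
    cross (W - Z) (X - Z) * ((W - Y) \<bullet> (X - Y))"
proof -
  define w1 w2 x1 x2 y1 y2 z1 z2 where
    "w1 = W$1 - c$1" "w2 = W$2 - c$2" "x1 = X$1 - c$1" "x2 = X$2 - c$2"
    "y1 = Y$1 - c$1" "y2 = Y$2 - c$2" "z1 = Z$1 - c$1" "z2 = Z$2 - c$2"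
  note d = this
  have "w1\<^sup>2 + w2\<^sup>2 = r\<^sup>2" "x1\<^sup>2 + x2\<^sup>2 = r\<^sup>2" "y1\<^sup>2 + y2\<^sup>2 = r\<^sup>2" "z1\<^sup>2 + z2\<^sup>2 = r\<^sup>2"
    using assms by (simp_all add: mem_sphere_plane d del: mem_sphere)
  hence "((w1 - y1) * (x2 - y2) - (w2 - y2) * (x1 - y1)) * ((w1 - z1) * (x1 - z1) + (w2 - z2) * (x2 - z2))
   = ((w1 - z1) * (x2 - z2) - (w2 - z2) * (x1 - z1)) * ((w1 - y1) * (x1 - y1) + (w2 - y2) * (x2 - y2))"
    by algebra
  thus ?thesis by (simp add: cross_def inner_plane d)
qed

text \<open>With \<open>W, X, Z\<close> fixed, the angle condition is a quadratic equation in \<open>Y\<close> whose leading part is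
  \<open>cross (W - Z) (X - Z)\<close> times the squared length, so for non-collinear \<open>W, X, Z\<close> it is the
  equation of their circle.\<close>

lemma inscribed_angle_converse:
  assumes "W \<in> sphere c r" "X \<in> sphere c r" "Z \<in> sphere c r"
    and "cross (W - Z) (X - Z) \<noteq> 0"
    and "cross (W - Y) (X - Y) * ((W - Z) \<bullet> (X - Z)) =
      cross (W - Z) (X - Z) * ((W - Y) \<bullet> (X - Y))"
  shows "Y \<in> sphere c r"
proof -
  have "cross (W - Z) (X - Z) * ((Y$1 - c$1)\<^sup>2 + (Y$2 - c$2)\<^sup>2) = cross (W - Z) (X - Z) * r\<^sup>2"
    using assms(1-3,5) unfolding mem_sphere_plane cross_def inner_plane vector_minus_component
    by algebra
  thus ?thesis
    using assms(1,4) by (simp add: mem_sphere_plane del: mem_sphere)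
qed

text \<open>A converse of Reim's theorem. Of the two lines, \<open>X' Z'\<close> is known to pass through the common point
  \<open>E\<close> of the circles; since \<open>X X'\<close> and \<open>Z Z'\<close> are parallel, the other line \<open>X Z\<close> passes through
  the common point \<open>Y\<close>. The reason is that the angles of \<open>Y E\<close> with \<open>Y X\<close> and with \<open>Y Z\<close> are
  equal, namely to the angles at \<open>X'\<close> and at \<open>Z'\<close>.\<close>

lemma reim:
  assumes K: "E \<in> sphere c r" "Y \<in> sphere c r" "X \<in> sphere c r" "X' \<in> sphere c r"
    and L: "E \<in> sphere c' r'" "Y \<in> sphere c' r'" "Z \<in> sphere c' r'" "Z' \<in> sphere c' r'"
    and "Y \<noteq> E" and gen: "cross (X - E) (X' - E) \<noteq> 0"
    and Z': "Z' - E = k *\<^sub>R (X' - E)" "Z' - Z = m *\<^sub>R (X' - X)" and nz: "k \<noteq> 0" "m \<noteq> 0"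
  shows "cross (X - Y) (Z - Y) = 0"
proof -
  define s where "s = cross (E - X') (X - X')"
  define d where "d = (E - X') \<bullet> (X - X')"
  have s0: "s \<noteq> 0"
    using gen by (simp add: s_def cross_def algebra_simps)
  have 1: "cross (E - Y) (X - Y) * d = s * ((E - Y) \<bullet> (X - Y))"
    using inscribed_angle[OF K(1,3,2,4)] by (simp add: s_def d_def)
  have EZ: "E - Z' = k *\<^sub>R (E - X')" "Z - Z' = m *\<^sub>R (X - X')"
    using Z' by (metis minus_diff_eq scaleR_minus_right)+
  have "(k * m) * (cross (E - Y) (Z - Y) * d) = (k * m) * (s * ((E - Y) \<bullet> (Z - Y)))"
    using inscribed_angle[OF L(1,3,2,4)] unfolding EZ
    by (simp add: s_def d_def cross_def algebra_simps)
  hence 2: "cross (E - Y) (Z - Y) * d = s * ((E - Y) \<bullet> (Z - Y))"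
    using nz by simp
  \<comment> \<open>By 1 and 2, both \<open>X - Y\<close> and \<open>Z - Y\<close> are orthogonal to one vector; its squared length is
    the factor in front of the cross product below.\<close>
  have "((E - Y) \<bullet> (E - Y)) * (d\<^sup>2 + s\<^sup>2) * cross (X - Y) (Z - Y) = 0"
    using 1 2 unfolding cross_def inner_plane by algebra
  moreover have "d\<^sup>2 + s\<^sup>2 \<noteq> 0"
    using s0 by (simp add: sum_power2_eq_zero_iff)
  ultimately show ?thesis
    using \<open>Y \<noteq> E\<close> by (metis eq_iff_diff_eq_0 inner_eq_zero_iff mult_eq_0_iff)
qed


section \<open>Chords of a central conic\<close>

locale central_conic =
  fixes M :: point and p q r :: real
  assumes det: "p * r - q\<^sup>2 \<noteq> 0"
begin

definition on_conic :: "point \<Rightarrow> bool" where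
  "on_conic X \<longleftrightarrow> p * (X$1 - M$1)\<^sup>2 + 2 * q * (X$1 - M$1) * (X$2 - M$2) + r * (X$2 - M$2)\<^sup>2 = 1"

text \<open>The matrix of the conic followed by the rotation through a right angle: \<open>J w\<close> is conjugate to \<open>w\<close>
  with respect to the conic.\<close>

definition J :: "point \<Rightarrow> point" where
  "J w = vector [- (q * w$1 + r * w$2), p * w$1 + q * w$2]"

lemma J_component [simp]: "J w $ 1 = - (q * w$1 + r * w$2)" "J w $ 2 = p * w$1 + q * w$2"
  by (simp_all add: J_def vector_2)

lemma J_diff: "J (u - v) = J u - J v"
  by (simp add: point_eq_iff algebra_simps)

lemma cross_J: "cross (J u) (J v) = (p * r - q\<^sup>2) * cross u v"
  by (simp add: cross_def power2_eq_square algebra_simps)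

text \<open>Up to sign, \<open>cross (J u) v\<close> is the symmetric bilinear form that belongs to the conic.\<close>

lemma cross_J_commute: "cross (J u) v = cross (J v) u"
  by (simp add: cross_def algebra_simps)

lemma J_eq_0_iff: "J w = 0 \<longleftrightarrow> w = 0"
proof
  assume "J w = 0"
  hence "q * w$1 + r * w$2 = 0" "p * w$1 + q * w$2 = 0"
    by (simp_all add: point_eq_iff)
  hence "(p * r - q\<^sup>2) * w$1 = 0" "(p * r - q\<^sup>2) * w$2 = 0"
    by algebra+
  thus "w = 0"
    using det by (simp add: point_eq_iff)
qed (simp add: point_eq_iff)

lemma half_turn_component [simp]: "half_turn M X $ i = 2 * M $ i - X $ i"
  by (simp add: half_turn_def)

lemma on_conic_half_turn: "on_conic (half_turn M X) \<longleftrightarrow> on_conic X"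
  by (simp add: on_conic_def power2_eq_square algebra_simps)

lemma half_turn_neq: "on_conic X \<Longrightarrow> half_turn M X \<noteq> X"
  by (auto simp: on_conic_def point_eq_iff)

text \<open>The sum and the difference of \<open>U - M\<close> and \<open>V - M\<close> are conjugate, because the quadratic form takes
  the same value at both vectors; and \<open>V - half_turn M U\<close> is their sum.\<close>

lemma supplementary_chord:
  assumes "on_conic U" "on_conic V" "U \<noteq> V"
  obtains k where "V - half_turn M U = k *\<^sub>R J (V - U)"
proof -
  have "cross (J (V - U)) (V - half_turn M U) = 0"
    using assms(1,2) unfolding on_conic_def cross_def J_component half_turn_component vector_minus_component
    by algebra
  moreover have "J (V - U) \<noteq> 0"
    using assms(3) by (simp add: J_eq_0_iff)
  ultimately show thesis
    using that cross_eq_0_iff by blast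
qed

text \<open>Along a line through three points of the conic the quadratic equation would hold identically. Then
  the direction of the line is isotropic and conjugate to \<open>U - M\<close>, against
  non-degeneracy.\<close>

lemma three_points_not_collinear:
  assumes "on_conic U" "on_conic V" "on_conic W" "U \<noteq> V" "U \<noteq> W" "V \<noteq> W"
  shows "cross (V - U) (W - U) \<noteq> 0"
proof
  assume "cross (V - U) (W - U) = 0"
  then obtain s where s: "W - U = s *\<^sub>R (V - U)"
    using assms(4) cross_eq_0_iff[of "V - U" "W - U"] by auto
  have "s \<noteq> 0" "s \<noteq> 1"
    using s assms(5,6) by auto
  define x y where "x = V$1 - U$1" "y = V$2 - U$2"
  define a b where "a = U$1 - M$1" "b = U$2 - M$2"
  have V: "V$1 - M$1 = a + x" "V$2 - M$2 = b + y"
    by (simp_all add: x_y_def a_b_def)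
  have "W$1 - U$1 = s * x" "W$2 - U$2 = s * y"
    using s by (simp_all add: point_eq_iff x_y_def)
  hence W: "W$1 - M$1 = a + s * x" "W$2 - M$2 = b + s * y"
    by (simp_all add: a_b_def)
  note eqs = assms(1-3)[unfolded on_conic_def V W, folded a_b_def]
  have "s * (s - 1) * (p * x\<^sup>2 + 2 * q * x * y + r * y\<^sup>2) = 0"
    using eqs by algebra
  hence 1: "p * x\<^sup>2 + 2 * q * x * y + r * y\<^sup>2 = 0"
    using \<open>s \<noteq> 0\<close> \<open>s \<noteq> 1\<close> by simp
  have 2: "p * a * x + q * (a * y + b * x) + r * b * y = 0"
    using eqs(1,2) 1 by algebra
  have "(p * r - q\<^sup>2) * x\<^sup>2 = 0" "(p * r - q\<^sup>2) * y\<^sup>2 = 0"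
    using 1 2 eqs(1) by algebra+
  hence "V = U"
    using det by (simp add: x_y_def point_eq_iff)
  with assms(4) show False by simp
qed

section \<open>Transporting the configuration by the conjugation map\<close>

text \<open>
  The points \<open>X\<close> arising from different \<open>A\<close> share one scale factor, which depends on \<open>D\<close> and \<open>P\<close>
  only: \<open>V \<mapsto> half_turn M D + t *\<^sub>R J (V - D)\<close> fixes \<open>P\<close>, and it sends each \<open>A\<close> to the intersection
  of the line from \<open>half_turn M A\<close> to \<open>P\<close> with the line from \<open>A\<close> to \<open>half_turn M D\<close>.\<close>

lemma projected_point:
  assumes "on_conic A" "on_conic D" "on_conic P"
    and "A \<noteq> D" "A \<noteq> P" "D \<noteq> P" "P \<noteq> half_turn M A" "A \<noteq> half_turn M D"
    and X: "lines_meet_at (half_turn M A) P A (half_turn M D) X"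
    and t: "P - half_turn M D = t *\<^sub>R J (P - D)"
  shows "X - half_turn M D = t *\<^sub>R J (A - D)"
proof -
  obtain k where k: "A - half_turn M D = k *\<^sub>R J (A - D)"
    using supplementary_chord[of D A] assms by metis
  obtain l where l: "P - half_turn M A = l *\<^sub>R J (P - A)"
    using supplementary_chord[of A P] assms by metis
  have "X \<in> line_through (half_turn M A) P" "X \<in> line_through A (half_turn M D)"
    using X unfolding lines_meet_at_def by blast+
  hence 1: "cross (P - half_turn M A) (X - half_turn M A) = 0"
    and "cross (half_turn M D - A) (X - A) = 0"
    using assms by (simp_all add: mem_line_through_iff)
  hence "cross (A - half_turn M D) (X - half_turn M D) = 0"
    by (simp add: cross_def algebra_simps)
  then obtain s where s: "X - half_turn M D = s *\<^sub>R J (A - D)"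
    using k assms(8) cross_eq_0_iff[of "A - half_turn M D"] by (metis eq_iff_diff_eq_0 scaleR_scaleR)
  have "l \<noteq> 0"
    using l assms(7) by auto
  with 1 l have "cross (J (P - A)) (X - half_turn M A) = 0"
    by (simp add: cross_def right_diff_distrib[symmetric] mult.assoc)
  moreover have "X - half_turn M A = A - D + s *\<^sub>R J (A - D)"
    using s by (simp add: point_eq_iff)
  ultimately have 2: "cross (J (P - A)) (A - D + s *\<^sub>R J (A - D)) = 0"
    by simp
  \<comment> \<open>The two bilinear values expand to the same expression, as the form is 1 at \<open>A\<close>, \<open>D\<close> and \<open>P\<close>.\<close>
  have 3: "cross (J (P - half_turn M D)) (A - D) = cross (J (P - A)) (A - D)"
    using assms(1-3) unfolding on_conic_def cross_def J_component half_turn_component vector_minus_component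
    by algebra
  have "cross (J (P - A)) (A - D) = cross (J (A - D)) (P - half_turn M D)"
    unfolding 3[symmetric] by (rule cross_J_commute)
  also have "\<dots> = t * ((p * r - q\<^sup>2) * cross (A - D) (P - D))"
    unfolding t by (simp add: cross_scaleR[of 1, simplified] cross_J)
  finally have 4: "cross (J (P - A)) (A - D) = t * ((p * r - q\<^sup>2) * cross (A - D) (P - D))" .
  have "cross (J (P - A)) (A - D + s *\<^sub>R J (A - D)) =
      cross (J (P - A)) (A - D) + s * ((p * r - q\<^sup>2) * cross (P - A) (A - D))"
    unfolding cross_J[symmetric] by (simp add: cross_def algebra_simps)
  also have "cross (P - A) (A - D) = - cross (A - D) (P - D)"
    by (simp add: cross_def algebra_simps)
  finally have "(s - t) * (p * r - q\<^sup>2) * cross (A - D) (P - D) = 0"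
    using 2 4 by (simp add: algebra_simps)
  moreover have "cross (A - D) (P - D) \<noteq> 0"
    using three_points_not_collinear[of D A P] assms by metis
  ultimately have "s = t"
    using det by simp
  with s show ?thesis by simp
qed

text \<open>With \<open>Z = J (X - M)\<close>, the squared length of \<open>Z\<close> is \<open>(X - M) \<bullet> Q\<^sup>2 (X - M)\<close>. Since
  \<open>Q\<^sup>2 = (p + r) Q - det Q\<close>, this is \<open>p + r\<close> minus \<open>det Q\<close> times the squared length of \<open>X - M\<close>. On a
  circle the latter is affine in \<open>X\<close>, hence in \<open>Z\<close>, so \<open>Z\<close> satisfies the equation of a circle.\<close>

lemma J_image_concyclic:
  obtains c' where "\<And>X Y. \<lbrakk>on_conic X; on_conic Y; X \<in> sphere c d; Y \<in> sphere c d\<rbrakk>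
    \<Longrightarrow> dist c' (J X) = dist c' (J Y)"
proof -
  \<comment> \<open>Comparing linear terms gives the centre \<open>J M - Q (R (c - M))\<close>, with \<open>R\<close> the quarter turn.\<close>
  define c' :: point where "c' = vector [J M $ 1 - (q * (c$1 - M$1) - p * (c$2 - M$2)),
    J M $ 2 - (r * (c$1 - M$1) - q * (c$2 - M$2))]"
  have c': "c'$1 = J M $ 1 - (q * (c$1 - M$1) - p * (c$2 - M$2))"
    "c'$2 = J M $ 2 - (r * (c$1 - M$1) - q * (c$2 - M$2))"
    by (simp_all add: c'_def vector_2)
  show thesis
  proof (rule that)
    fix X Y
    assume X: "on_conic X" "on_conic Y" and "X \<in> sphere c d" "Y \<in> sphere c d"
    hence "dist c X = dist c Y" by simp
    with X show "dist c' (J X) = dist c' (J Y)"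
      unfolding dist_eq_iff_plane c' J_component on_conic_def by algebra
  qed
qed

text \<open>The points \<open>X, Y, Z\<close> and \<open>half_turn M D\<close> are the images of the concyclic points
  \<open>J A, J B, J C, J D\<close> under the similarity
  \<open>V \<mapsto> half_turn M D + t *\<^sub>R (V - J D)\<close>.\<close>

lemma fourth_point_on_circle:
  assumes conic: "on_conic A" "on_conic B" "on_conic C" "on_conic D"
    and circle: "A \<in> sphere c d" "B \<in> sphere c d" "C \<in> sphere c d" "D \<in> sphere c d"
    and X: "X - half_turn M D = t *\<^sub>R J (A - D)"
    and Y: "Y - half_turn M D = t *\<^sub>R J (B - D)"
    and Z: "Z - half_turn M D = t *\<^sub>R J (C - D)"
    and XYZ: "\<not> collinear {X, Y, Z}"
  shows "half_turn M D \<in> circumcircle X Y Z"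
proof -
  obtain c' where c': "\<And>U V. \<lbrakk>on_conic U; on_conic V; U \<in> sphere c d; V \<in> sphere c d\<rbrakk>
    \<Longrightarrow> dist c' (J U) = dist c' (J V)"
    using J_image_concyclic by blast
  define E where "E = half_turn M D"
  define \<phi> where "\<phi> W = E + t *\<^sub>R (W - J D)" for W
  have dist: "dist (\<phi> c') (\<phi> W) = \<bar>t\<bar> * dist c' W" for W
    by (simp add: \<phi>_def dist_norm flip: scaleR_diff_right)
  have im: "X = \<phi> (J A)" "Y = \<phi> (J B)" "Z = \<phi> (J C)" "E = \<phi> (J D)"
    using X Y Z unfolding J_diff \<phi>_def E_def by (simp_all add: algebra_simps)
  define S where "S = sphere (\<phi> c') (\<bar>t\<bar> * dist c' (J D))"
  have mem: "X \<in> S" "Y \<in> S" "Z \<in> S" "E \<in> S"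
    unfolding S_def im mem_sphere dist using c' conic circle by metis+
  have "X \<noteq> Y"
    using XYZ by auto
  hence "0 < \<bar>t\<bar> * dist c' (J D)"
    using mem(1,2) unfolding S_def mem_sphere
    by (metis dist_eq_0_iff less_eq_real_def zero_le_dist)
  hence "is_circle S"
    unfolding S_def is_circle_def by blast
  hence "circumcircle X Y Z = S"
    using ex1_circumcircle[OF XYZ] circumcircle_props[OF XYZ] mem by blast
  with mem show ?thesis
    unfolding E_def by simp
qed

text \<open>The four lines from the antipodes of \<open>A\<close> and \<open>D\<close> to \<open>B\<close> and \<open>C\<close> are parallel to the lines from
  \<open>J A\<close> and \<open>J D\<close> to \<open>J B\<close> and \<open>J C\<close>, so the inscribed angles over \<open>J B, J C\<close> become equal angles
  over \<open>B, C\<close>.\<close>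

lemma half_turn_concyclic:
  assumes conic: "on_conic A" "on_conic B" "on_conic C" "on_conic D"
    and distinct: "A \<noteq> B" "A \<noteq> C" "B \<noteq> D" "C \<noteq> D"
    and circle: "A \<in> sphere c d" "B \<in> sphere c d" "C \<in> sphere c d" "D \<in> sphere c d"
    and K: "B \<in> sphere c1 d1" "C \<in> sphere c1 d1" "half_turn M D \<in> sphere c1 d1"
    and BCE: "\<not> collinear {B, C, half_turn M D}"
  shows "half_turn M A \<in> sphere c1 d1"
proof -
  obtain c' where c': "\<And>U V. \<lbrakk>on_conic U; on_conic V; U \<in> sphere c d; V \<in> sphere c d\<rbrakk>
    \<Longrightarrow> dist c' (J U) = dist c' (J V)"
    using J_image_concyclic by blast
  have "J B \<in> sphere c' (dist c' (J D))" "J C \<in> sphere c' (dist c' (J D))"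
    "J A \<in> sphere c' (dist c' (J D))" "J D \<in> sphere c' (dist c' (J D))"
    using c' conic circle unfolding mem_sphere by metis+
  from inscribed_angle[OF this]
  have angle: "cross (J (B - A)) (J (C - A)) * (J (B - D) \<bullet> J (C - D)) =
      cross (J (B - D)) (J (C - D)) * (J (B - A) \<bullet> J (C - A))"
    by (simp only: J_diff)
  obtain k where k: "B - half_turn M A = k *\<^sub>R J (B - A)"
    using supplementary_chord[of A B] assms by metis
  obtain l where l: "C - half_turn M A = l *\<^sub>R J (C - A)"
    using supplementary_chord[of A C] assms by metis
  obtain m where m: "B - half_turn M D = m *\<^sub>R J (B - D)"
    using supplementary_chord[of D B] assms by metis
  obtain n where n: "C - half_turn M D = n *\<^sub>R J (C - D)"
    using supplementary_chord[of D C] assms by metis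
  have "cross (B - half_turn M A) (C - half_turn M A) * ((B - half_turn M D) \<bullet> (C - half_turn M D)) =
      cross (B - half_turn M D) (C - half_turn M D) * ((B - half_turn M A) \<bullet> (C - half_turn M A))"
    unfolding k l m n cross_scaleR inner_scaleR_left inner_scaleR_right
    using arg_cong[OF angle, of "(*) (k * l * m * n)"] by (simp add: mult_ac)
  moreover have "cross (B - half_turn M D) (C - half_turn M D) \<noteq> 0"
    using not_collinear_det[OF BCE] by (simp add: cross_def algebra_simps)
  ultimately show ?thesis
    using inscribed_angle_converse K by blast
qed

text \<open>The four concyclic points and their antipodes are eight different points; \<open>apart\<close> records this for
  one pair, so that permuting the four points permutes the conditions.\<close>

definition apart :: "point \<Rightarrow> point \<Rightarrow> bool" where
  "apart U V \<longleftrightarrow> U \<noteq> V \<and> half_turn M U \<noteq> V"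

lemma apart_sym: "apart U V \<Longrightarrow> apart V U"
  by (auto simp: apart_def half_turn_def)

text \<open>Reim's configuration: \<open>half_turn M D\<close> and \<open>W\<close> are the common points of the circle of \<open>X, Y\<close> and the
  circle of \<open>half_turn M A, B\<close>, and the direction of \<open>X Y\<close> and of the line from \<open>half_turn M A\<close> to
  \<open>B\<close> is \<open>J (B - A)\<close>.\<close>

lemma line_to_second_intersection:
  assumes conic: "on_conic A" "on_conic B" "on_conic C" "on_conic D"
    and apart: "apart A B" "apart A C" "apart A D" "apart B D" "apart C D"
    and circle: "A \<in> sphere c d" "B \<in> sphere c d" "C \<in> sphere c d" "D \<in> sphere c d"
    and X: "lines_meet_at (half_turn M A) P A (half_turn M D) X"
    and Xt: "X - half_turn M D = t *\<^sub>R J (A - D)"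
    and Yt: "Y - half_turn M D = t *\<^sub>R J (B - D)" and t: "t \<noteq> 0"
    and S: "X \<in> sphere c1 d1" "Y \<in> sphere c1 d1" "half_turn M D \<in> sphere c1 d1"
    and BCE: "\<not> collinear {B, C, half_turn M D}"
    and W: "circles_meet_again (circumcircle B C (half_turn M D)) (sphere c1 d1) (half_turn M D) W"
    and XW: "X \<noteq> W"
  shows "P \<in> line_through X W"
proof -
  define E where "E = half_turn M D"
  define A' where "A' = half_turn M A"
  obtain c2 d2 where K: "circumcircle B C (half_turn M D) = sphere c2 d2"
    using circumcircle_props(1)[OF BCE] by (auto simp: is_circle_def)
  note onK = circumcircle_props(2-4)[OF BCE, unfolded K]
  have W: "W \<noteq> E" "W \<in> sphere c1 d1" "W \<in> sphere c2 d2"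
    using W unfolding circles_meet_again_def K E_def by blast+
  have ne: "A \<noteq> B" "A \<noteq> C" "A \<noteq> D" "B \<noteq> D" "C \<noteq> D"
    using apart by (simp_all add: apart_def)
  obtain k where k: "B - E = k *\<^sub>R J (B - D)"
    unfolding E_def using supplementary_chord[OF conic(4,2)] ne by metis
  obtain m where m: "B - A' = m *\<^sub>R J (B - A)"
    unfolding A'_def using supplementary_chord[OF conic(1,2)] ne by metis
  obtain n where n: "A - E = n *\<^sub>R J (A - D)"
    unfolding E_def using supplementary_chord[OF conic(4,1)] ne by metis
  have AE: "E \<noteq> A" and BE: "E \<noteq> B"
    using apart(3,4)[THEN apart_sym] by (auto simp: E_def apart_def)
  have EA': "E \<noteq> A'"
    using ne(3) by (auto simp: E_def A'_def half_turn_def)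
  have BA': "A' \<noteq> B"
    using apart(1) by (simp add: apart_def A'_def)
  have A'K: "A' \<in> sphere c2 d2"
    unfolding A'_def using half_turn_concyclic[OF conic ne(1,2,4,5) circle onK BCE] .
  have "Y - X = (Y - half_turn M D) - (X - half_turn M D)"
    by simp
  also have "\<dots> = t *\<^sub>R J (B - A)"
    unfolding Xt Yt by (simp add: J_diff flip: scaleR_diff_right)
  finally have YX: "Y - X = t *\<^sub>R J (B - A)" .
  have par: "B - E = (k / t) *\<^sub>R (Y - E)" "B - A' = (m / t) *\<^sub>R (Y - X)"
    using k m t unfolding E_def Yt YX by simp_all
  have "cross (A - D) (B - D) \<noteq> 0"
    using three_points_not_collinear[OF conic(4,1,2)] ne by blast
  hence gen: "cross (X - E) (Y - E) \<noteq> 0"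
    using Xt Yt t det by (simp add: E_def cross_scaleR cross_J)
  have "cross (X - W) (A' - W) = 0"
  proof (rule reim[OF _ W(2) S(1,2) _ W(3) A'K onK(1) _ gen par])
    show "k / t \<noteq> 0" "m / t \<noteq> 0"
      using t k m BE BA' by auto
  qed (use S onK W in \<open>simp_all add: E_def\<close>)
  hence c1: "cross (A' - X) (W - X) = 0"
    by (simp add: cross_def algebra_simps)
  \<comment> \<open>Otherwise the line \<open>A E\<close> would contain the third conic point \<open>A'\<close>.\<close>
  have "A' \<noteq> X"
  proof
    assume "A' = X"
    hence A': "A' - E = t *\<^sub>R J (A - D)"
      using Xt E_def by metis
    have "cross (A - E) (A' - E) = 0"
      unfolding n A' cross_scaleR by (simp add: cross_def)
    moreover have "cross (A - E) (A' - E) \<noteq> 0"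
      using three_points_not_collinear[of E A A'] conic(1,4) AE EA' half_turn_neq[of A] on_conic_half_turn
      unfolding E_def A'_def by metis
    ultimately show False by contradiction
  qed
  moreover have "A' \<noteq> P" "X \<in> line_through A' P"
    using X unfolding A'_def lines_meet_at_def by blast+
  hence "cross (A' - X) (P - X) = 0"
    by (simp add: mem_line_through_iff cross_def) (simp add: algebra_simps)
  ultimately have "cross (W - X) (P - X) = 0"
    using c1 cross_trans[of "A' - X"] by simp
  thus ?thesis
    using XW by (simp add: mem_line_through_iff)
qed

text \<open>One quarter of the theorem: everything about the circle through the antipode of \<open>D\<close>. Its conclusions
  about \<open>Y\<close> and \<open>Z\<close> are those about \<open>X\<close> after permuting \<open>A, B, C\<close>.\<close>

lemma configuration_at_antipode:
  assumes conic: "on_conic A" "on_conic B" "on_conic C" "on_conic D" "on_conic P"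
    and circle: "is_circle \<Gamma>" "A \<in> \<Gamma>" "B \<in> \<Gamma>" "C \<in> \<Gamma>" "D \<in> \<Gamma>"
    and apart: "apart A B" "apart A C" "apart A D" "apart B C" "apart B D" "apart C D"
    and P: "P \<notin> \<Gamma>" "P \<noteq> half_turn M A" "P \<noteq> half_turn M B" "P \<noteq> half_turn M C" "P \<noteq> half_turn M D"
    and X: "lines_meet_at (half_turn M A) P A (half_turn M D) X"
    and Y: "lines_meet_at (half_turn M B) P B (half_turn M D) Y"
    and Z: "lines_meet_at (half_turn M C) P C (half_turn M D) Z"
    and XYZ: "\<not> collinear {X, Y, Z}"
  shows "half_turn M D \<in> circumcircle X Y Z"
    and "\<not> collinear {B, C, half_turn M D} \<Longrightarrow>
      circles_meet_again (circumcircle B C (half_turn M D)) (circumcircle X Y Z) (half_turn M D) W \<Longrightarrow>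
      X \<noteq> W \<Longrightarrow> P \<in> line_through X W"
    and "\<not> collinear {A, C, half_turn M D} \<Longrightarrow>
      circles_meet_again (circumcircle A C (half_turn M D)) (circumcircle X Y Z) (half_turn M D) W \<Longrightarrow>
      Y \<noteq> W \<Longrightarrow> P \<in> line_through Y W"
    and "\<not> collinear {A, B, half_turn M D} \<Longrightarrow>
      circles_meet_again (circumcircle A B (half_turn M D)) (circumcircle X Y Z) (half_turn M D) W \<Longrightarrow>
      Z \<noteq> W \<Longrightarrow> P \<in> line_through Z W"
proof -
  obtain c d where \<Gamma>: "\<Gamma> = sphere c d"
    using circle(1) by (auto simp: is_circle_def)
  note on_\<Gamma> = circle(2-5)[unfolded \<Gamma>]
  have PD: "A \<noteq> P" "B \<noteq> P" "C \<noteq> P" "D \<noteq> P"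
    using P(1) circle by auto
  obtain t where t: "P - half_turn M D = t *\<^sub>R J (P - D)"
    using supplementary_chord[OF conic(4,5) PD(4)] by metis
  have t0: "t \<noteq> 0"
    using t P(5) by auto
  have ne: "A \<noteq> D" "B \<noteq> D" "C \<noteq> D" "A \<noteq> half_turn M D" "B \<noteq> half_turn M D" "C \<noteq> half_turn M D"
    using apart(3,5,6) apart(3,5,6)[THEN apart_sym] by (auto simp: apart_def)
  have Xt: "X - half_turn M D = t *\<^sub>R J (A - D)"
    by (rule projected_point[OF conic(1,4,5) ne(1) PD(1,4) P(2) ne(4) X t])
  have Yt: "Y - half_turn M D = t *\<^sub>R J (B - D)"
    by (rule projected_point[OF conic(2,4,5) ne(2) PD(2,4) P(3) ne(5) Y t])
  have Zt: "Z - half_turn M D = t *\<^sub>R J (C - D)"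
    by (rule projected_point[OF conic(3,4,5) ne(3) PD(3,4) P(4) ne(6) Z t])
  show E: "half_turn M D \<in> circumcircle X Y Z"
    by (rule fourth_point_on_circle[OF conic(1,2,3,4) on_\<Gamma> Xt Yt Zt XYZ])
  obtain c1 d1 where S: "circumcircle X Y Z = sphere c1 d1"
    using circumcircle_props(1)[OF XYZ] by (auto simp: is_circle_def)
  note on_S = circumcircle_props(2-4)[OF XYZ, unfolded S] E[unfolded S]
  show "P \<in> line_through X W" if "\<not> collinear {B, C, half_turn M D}" "X \<noteq> W"
      "circles_meet_again (circumcircle B C (half_turn M D)) (circumcircle X Y Z) (half_turn M D) W"
    by (rule line_to_second_intersection[OF conic(1,2,3,4) apart(1,2,3,5,6)
          on_\<Gamma>(1,2,3,4) X Xt Yt t0 on_S(1,2,4) that(1) that(3)[unfolded S] that(2)])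
  show "P \<in> line_through Y W" if "\<not> collinear {A, C, half_turn M D}" "Y \<noteq> W"
      "circles_meet_again (circumcircle A C (half_turn M D)) (circumcircle X Y Z) (half_turn M D) W"
    by (rule line_to_second_intersection[OF conic(2,1,3,4) apart(1)[THEN apart_sym] apart(4,5,3,6)
          on_\<Gamma>(2,1,3,4) Y Yt Xt t0 on_S(2,1,4) that(1) that(3)[unfolded S] that(2)])
  show "P \<in> line_through Z W" if "\<not> collinear {A, B, half_turn M D}" "Z \<noteq> W"
      "circles_meet_again (circumcircle A B (half_turn M D)) (circumcircle X Y Z) (half_turn M D) W"
    by (rule line_to_second_intersection[OF conic(3,1,2,4) apart(2,4)[THEN apart_sym] apart(6,3,5)
          on_\<Gamma>(3,1,2,4) Z Zt Xt t0 on_S(3,1,4) that(1) that(3)[unfolded S] that(2)])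
qed

end

section \<open>From standard equations to the four circles\<close>

text \<open>
  In an orthonormal frame \<open>u, v\<close> the matrix of the conic is \<open>f u u\<^sup>T + g v v\<^sup>T\<close>, where \<open>g\<close> is negative
  for a hyperbola; its determinant is \<open>f g\<close>.\<close>

lemma is_central_conic_equation:
  assumes "is_central_conic M K"
  obtains p q r where "central_conic p q r" "\<And>X. X \<in> K \<Longrightarrow> central_conic.on_conic M p q r X"
proof -
  obtain u v a b s where uv: "norm u = 1" "norm v = 1" "u \<bullet> v = 0" and "0 < a" "0 < b"
    and s: "s = 1 \<or> s = -1"
    and K: "K = {M + x *\<^sub>R u + y *\<^sub>R v | x y. x\<^sup>2 / a\<^sup>2 + s * (y\<^sup>2 / b\<^sup>2) = 1}"
  proof -
    consider "is_ellipse M K" | "is_hyperbola M K"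
      using assms unfolding is_central_conic_def by blast
    thus thesis
    proof cases
      case 1
      thus thesis unfolding is_ellipse_def by (elim exE conjE) (rule that[of _ _ _ _ 1], simp_all)
    next
      case 2
      thus thesis unfolding is_hyperbola_def by (elim exE conjE) (rule that[of _ _ _ _ "-1"], simp_all)
    qed
  qed
  define f g where "f = 1 / a\<^sup>2" "g = s / b\<^sup>2"
  have fg: "f * g \<noteq> 0"
    using \<open>0 < a\<close> \<open>0 < b\<close> s by (auto simp: f_g_def)
  have o: "u$1 * u$1 + u$2 * u$2 = 1" "v$1 * v$1 + v$2 * v$2 = 1" "u$1 * v$1 + u$2 * v$2 = 0"
    using uv unfolding norm_eq_1 inner_plane by simp_all
  define p q r where "p = f * (u$1)\<^sup>2 + g * (v$1)\<^sup>2" "q = f * u$1 * u$2 + g * v$1 * v$2"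
    "r = f * (u$2)\<^sup>2 + g * (v$2)\<^sup>2"
  note pqr = this
  have "p * r - q\<^sup>2 = f * g"
    unfolding pqr using o by algebra
  hence cc: "central_conic p q r"
    using fg by unfold_locales simp
  moreover have "central_conic.on_conic M p q r X" if "X \<in> K" for X
  proof -
    obtain x y where X: "X = M + x *\<^sub>R u + y *\<^sub>R v" and "x\<^sup>2 / a\<^sup>2 + s * (y\<^sup>2 / b\<^sup>2) = 1"
      using \<open>X \<in> K\<close> unfolding K by blast
    hence xy: "f * x\<^sup>2 + g * y\<^sup>2 = 1"
      by (simp add: f_g_def)
    have "X$1 - M$1 = x * u$1 + y * v$1" "X$2 - M$2 = x * u$2 + y * v$2"
      by (simp_all add: X)
    thus ?thesis
      unfolding central_conic.on_conic_def[OF cc] unfolding pqr using o xy by algebra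
  qed
  ultimately show thesis
    using that by blast
qed


theorem theorem6:
  fixes A B C D M P :: point
    and A\<^sub>1 B\<^sub>2 C\<^sub>3 D\<^sub>4 :: point
    and A\<^sub>4 B\<^sub>4 C\<^sub>4
      B\<^sub>1 C\<^sub>1 D\<^sub>1
      A\<^sub>2 C\<^sub>2 D\<^sub>2
      A\<^sub>3 B\<^sub>3 D\<^sub>3 :: point
    and A\<^sub>4' B\<^sub>4' C\<^sub>4'
      B\<^sub>1' C\<^sub>1' D\<^sub>1'
      A\<^sub>2' C\<^sub>2' D\<^sub>2'
      A\<^sub>3' B\<^sub>3' D\<^sub>3' :: point
    and \<Gamma> \<C> \<Sigma>\<^sub>4 \<Sigma>\<^sub>1 \<Sigma>\<^sub>2 \<Sigma>\<^sub>3 :: "point set"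
  assumes "\<not> collinear {A, B, C}"
      and "\<Gamma> = circumcircle A B C"
      and "D\<^sub>4 \<noteq> A" and "D\<^sub>4 \<noteq> B" and "D\<^sub>4 \<noteq> C"
      and "\<not> is_orthocentre A B C D\<^sub>4"
      and "is_central_conic M \<C>"
      and "A \<in> \<C>" and "B \<in> \<C>" and "C \<in> \<C>" and "D\<^sub>4 \<in> \<C>"
      and "D = half_turn M D\<^sub>4" and "D \<in> \<Gamma>"
      and "D \<noteq> A" and "D \<noteq> B" and "D \<noteq> C"
      and "A\<^sub>1 = half_turn M A" and "B\<^sub>2 = half_turn M B" and "C\<^sub>3 = half_turn M C"
      and "P \<in> \<C>" and "P \<notin> \<Gamma>"
      and "P \<notin> line_through B C" and "P \<notin> line_through C A" and "P \<notin> line_through A B"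
      and "P \<noteq> A\<^sub>1" and "P \<noteq> B\<^sub>2" and "P \<noteq> C\<^sub>3" and "P \<noteq> D\<^sub>4"
      and "lines_meet_at A\<^sub>1 P A D\<^sub>4 A\<^sub>4"
      and "lines_meet_at B\<^sub>2 P B D\<^sub>4 B\<^sub>4"
      and "lines_meet_at C\<^sub>3 P C D\<^sub>4 C\<^sub>4"
      and "lines_meet_at B\<^sub>2 P B A\<^sub>1 B\<^sub>1"
      and "lines_meet_at C\<^sub>3 P C A\<^sub>1 C\<^sub>1"
      and "lines_meet_at D\<^sub>4 P D A\<^sub>1 D\<^sub>1"
      and "lines_meet_at A\<^sub>1 P A B\<^sub>2 A\<^sub>2"
      and "lines_meet_at C\<^sub>3 P C B\<^sub>2 C\<^sub>2"
      and "lines_meet_at D\<^sub>4 P D B\<^sub>2 D\<^sub>2"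
      and "lines_meet_at A\<^sub>1 P A C\<^sub>3 A\<^sub>3"
      and "lines_meet_at B\<^sub>2 P B C\<^sub>3 B\<^sub>3"
      and "lines_meet_at D\<^sub>4 P D C\<^sub>3 D\<^sub>3"
      and "\<not> collinear {A\<^sub>4, B\<^sub>4, C\<^sub>4}"
      and "\<not> collinear {B\<^sub>1, C\<^sub>1, D\<^sub>1}"
      and "\<not> collinear {A\<^sub>2, C\<^sub>2, D\<^sub>2}"
      and "\<not> collinear {A\<^sub>3, B\<^sub>3, D\<^sub>3}"
      and "\<Sigma>\<^sub>4 = circumcircle A\<^sub>4 B\<^sub>4 C\<^sub>4"
      and "\<Sigma>\<^sub>1 = circumcircle B\<^sub>1 C\<^sub>1 D\<^sub>1"
      and "\<Sigma>\<^sub>2 = circumcircle A\<^sub>2 C\<^sub>2 D\<^sub>2"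
      and "\<Sigma>\<^sub>3 = circumcircle A\<^sub>3 B\<^sub>3 D\<^sub>3"
      and "\<not> collinear {B, C, D\<^sub>4}"
      and "\<not> collinear {C, A, D\<^sub>4}"
      and "\<not> collinear {A, B, D\<^sub>4}"
      and "\<not> collinear {C, D, A\<^sub>1}"
      and "\<not> collinear {B, D, A\<^sub>1}"
      and "\<not> collinear {B, C, A\<^sub>1}"
      and "\<not> collinear {C, D, B\<^sub>2}"
      and "\<not> collinear {A, D, B\<^sub>2}"
      and "\<not> collinear {A, C, B\<^sub>2}"
      and "\<not> collinear {B, D, C\<^sub>3}"
      and "\<not> collinear {A, D, C\<^sub>3}"
      and "\<not> collinear {A, B, C\<^sub>3}"
  shows "D\<^sub>4 \<in> \<Sigma>\<^sub>4 \<and>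
         (circles_meet_again (circumcircle B C D\<^sub>4) \<Sigma>\<^sub>4 D\<^sub>4 A\<^sub>4' \<longrightarrow>
          A\<^sub>4 \<noteq> A\<^sub>4' \<longrightarrow> P \<in> line_through A\<^sub>4 A\<^sub>4') \<and>
         (circles_meet_again (circumcircle C A D\<^sub>4) \<Sigma>\<^sub>4 D\<^sub>4 B\<^sub>4' \<longrightarrow>
          B\<^sub>4 \<noteq> B\<^sub>4' \<longrightarrow> P \<in> line_through B\<^sub>4 B\<^sub>4') \<and>
         (circles_meet_again (circumcircle A B D\<^sub>4) \<Sigma>\<^sub>4 D\<^sub>4 C\<^sub>4' \<longrightarrow>
          C\<^sub>4 \<noteq> C\<^sub>4' \<longrightarrow> P \<in> line_through C\<^sub>4 C\<^sub>4') \<and>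
         A\<^sub>1 \<in> \<Sigma>\<^sub>1 \<and>
         (circles_meet_again (circumcircle C D A\<^sub>1) \<Sigma>\<^sub>1 A\<^sub>1 B\<^sub>1' \<longrightarrow>
          B\<^sub>1 \<noteq> B\<^sub>1' \<longrightarrow> P \<in> line_through B\<^sub>1 B\<^sub>1') \<and>
         (circles_meet_again (circumcircle B D A\<^sub>1) \<Sigma>\<^sub>1 A\<^sub>1 C\<^sub>1' \<longrightarrow>
          C\<^sub>1 \<noteq> C\<^sub>1' \<longrightarrow> P \<in> line_through C\<^sub>1 C\<^sub>1') \<and>
         (circles_meet_again (circumcircle B C A\<^sub>1) \<Sigma>\<^sub>1 A\<^sub>1 D\<^sub>1' \<longrightarrow>
          D\<^sub>1 \<noteq> D\<^sub>1' \<longrightarrow> P \<in> line_through D\<^sub>1 D\<^sub>1') \<and>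
         B\<^sub>2 \<in> \<Sigma>\<^sub>2 \<and>
         (circles_meet_again (circumcircle C D B\<^sub>2) \<Sigma>\<^sub>2 B\<^sub>2 A\<^sub>2' \<longrightarrow>
          A\<^sub>2 \<noteq> A\<^sub>2' \<longrightarrow> P \<in> line_through A\<^sub>2 A\<^sub>2') \<and>
         (circles_meet_again (circumcircle A D B\<^sub>2) \<Sigma>\<^sub>2 B\<^sub>2 C\<^sub>2' \<longrightarrow>
          C\<^sub>2 \<noteq> C\<^sub>2' \<longrightarrow> P \<in> line_through C\<^sub>2 C\<^sub>2') \<and>
         (circles_meet_again (circumcircle A C B\<^sub>2) \<Sigma>\<^sub>2 B\<^sub>2 D\<^sub>2' \<longrightarrow>
          D\<^sub>2 \<noteq> D\<^sub>2' \<longrightarrow> P \<in> line_through D\<^sub>2 D\<^sub>2') \<and>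
         C\<^sub>3 \<in> \<Sigma>\<^sub>3 \<and>
         (circles_meet_again (circumcircle B D C\<^sub>3) \<Sigma>\<^sub>3 C\<^sub>3 A\<^sub>3' \<longrightarrow>
          A\<^sub>3 \<noteq> A\<^sub>3' \<longrightarrow> P \<in> line_through A\<^sub>3 A\<^sub>3') \<and>
         (circles_meet_again (circumcircle A D C\<^sub>3) \<Sigma>\<^sub>3 C\<^sub>3 B\<^sub>3' \<longrightarrow>
          B\<^sub>3 \<noteq> B\<^sub>3' \<longrightarrow> P \<in> line_through B\<^sub>3 B\<^sub>3') \<and>
         (circles_meet_again (circumcircle A B C\<^sub>3) \<Sigma>\<^sub>3 C\<^sub>3 D\<^sub>3' \<longrightarrow>
          D\<^sub>3 \<noteq> D\<^sub>3' \<longrightarrow> P \<in> line_through D\<^sub>3 D\<^sub>3')"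
proof -
  have \<Gamma>: "is_circle \<Gamma>" "A \<in> \<Gamma>" "B \<in> \<Gamma>" "C \<in> \<Gamma>" "D \<in> \<Gamma>"
    using circumcircle_props[OF assms(1)] assms(2,13) by simp_all
  have ht: "half_turn M (half_turn M X) = X" for X
    by (simp add: half_turn_def)
  have D\<^sub>4: "D\<^sub>4 = half_turn M D"
    using assms by (simp add: ht)
  obtain p q r where "central_conic p q r"
    and on: "\<And>X. X \<in> \<C> \<Longrightarrow> central_conic.on_conic M p q r X"
    using is_central_conic_equation[OF \<open>is_central_conic M \<C>\<close>] by metis
  interpret central_conic M p q r by fact
  have conic: "on_conic A" "on_conic B" "on_conic C" "on_conic D" "on_conic P"
    using on assms on_conic_half_turn D\<^sub>4 by blast+
  have ne: "A \<noteq> B" "A \<noteq> C" "B \<noteq> C"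
    using \<open>\<not> collinear {A, B, C}\<close> by (auto simp: insert_commute)
  have "A\<^sub>1 \<noteq> B" "A\<^sub>1 \<noteq> C" "A\<^sub>1 \<noteq> D" "B\<^sub>2 \<noteq> C" "B\<^sub>2 \<noteq> D" "C\<^sub>3 \<noteq> D"
    using \<open>\<not> collinear {B, C, A\<^sub>1}\<close> \<open>\<not> collinear {C, D, A\<^sub>1}\<close> \<open>\<not> collinear {A, C, B\<^sub>2}\<close>
      \<open>\<not> collinear {C, D, B\<^sub>2}\<close> \<open>\<not> collinear {B, D, C\<^sub>3}\<close>
    by (auto simp: insert_commute)
  hence apart: "apart A B" "apart A C" "apart A D" "apart B C" "apart B D" "apart C D"
    using ne assms(14-19) by (auto simp: apart_def)
  have swap: "circumcircle C A D\<^sub>4 = circumcircle A C D\<^sub>4" "{C, A, D\<^sub>4} = {A, C, D\<^sub>4}"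
    by (auto simp: circumcircle_def conj_ac)
  note antipodes = assms(17-19) D\<^sub>4
  note P = assms(21,25-28)[unfolded antipodes]
  note apart' = apart[THEN apart_sym]
  \<comment> \<open>The same lemma with \<open>D\<close>, \<open>A\<close>, \<open>B\<close>, \<open>C\<close> in turn as the point whose antipode lies on the circle.\<close>
  note at_D\<^sub>4 = configuration_at_antipode[OF conic(1,2,3,4,5) \<Gamma>(1,2,3,4,5)
      apart(1,2,3,4,5,6) P(1,2,3,4,5) assms(29-31)[unfolded antipodes] assms(41),
      folded antipodes assms(45)]
  note at_A\<^sub>1 = configuration_at_antipode[OF conic(2,3,4,1,5) \<Gamma>(1,3,4,5,2)
      apart(4,5) apart'(1) apart(6) apart'(2,3) P(1,3,4,5,2) assms(32-34)[unfolded antipodes] assms(42),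
      folded antipodes assms(46)]
  note at_B\<^sub>2 = configuration_at_antipode[OF conic(1,3,4,2,5) \<Gamma>(1,2,4,5,3)
      apart(2,3,1,6) apart'(4,5) P(1,2,4,5,3) assms(35-37)[unfolded antipodes] assms(43),
      folded antipodes assms(47)]
  note at_C\<^sub>3 = configuration_at_antipode[OF conic(1,2,4,3,5) \<Gamma>(1,2,3,5,4)
      apart(1,3,2,5,4) apart'(6) P(1,2,3,5,4) assms(38-40)[unfolded antipodes] assms(44),
      folded antipodes assms(48)]
  show ?thesis
    unfolding swap(1)
    by (intro conjI impI; (rule at_D\<^sub>4 at_A\<^sub>1 at_B\<^sub>2 at_C\<^sub>3; use assms(49-60) swap(2) in simp))
qed

end
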